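(* Let $n\ge 1$ and let $A=(a_1,\ldots,a_n)$ and $B=(b_1,\ldots,b_n)$ be sequences of real numbers such that $A$ is strictly decreasing, $B$ is strictly increasing, $a_i>b_{n+1-i}$ for every $i$, and $a_i\neq b_j$ for all $i,j$. Define the $n\times n$ matrix $M=\mathbf{C}(A,B)=(c_{ij})_{i,j=1}^n$ by $c_{ij}=\frac{1}{a_i-b_j}$ if $a_i>b_j$ and $c_{ij}=0$ if $a_i<b_j$. Then $M$ is nonsingular. Furthermore, $\det(M)>0$ if $\omega(M)$ is even and $\det(M)<0$ if $\omega(M)$ is odd, where $\omega(M)$ denotes the number of zero entries of $M$.
   Context: A matrix of the form $\mathbf{C}(A,B)$ with $A,B$ as in the claim is called a restricted real Cauchy matrix. *)

theory Defs
  imports "Jordan_Normal_Form.Determinant"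
begin

text \<open>
  Sequences of length \<open>n\<close> are functions used on \<open>{..<n}\<close>, and matrix indices start at 0,
  so the entry \<open>(i, j)\<close> here is the entry \<open>(i + 1, j + 1)\<close> in one-based notation.
  The matrix is only of interest when \<open>a i \<noteq> b j\<close> for all \<open>i, j < n\<close>; then the \<open>else\<close>
  branch is exactly the case \<open>a i < b j\<close>.
\<close>

definition cauchy_mat :: "nat \<Rightarrow> (nat \<Rightarrow> real) \<Rightarrow> (nat \<Rightarrow> real) \<Rightarrow> real mat" where
  "cauchy_mat n a b = mat n n (\<lambda>(i, j). if a i > b j then 1 / (a i - b j) else 0)"

definition num_zero_entries :: "'a :: zero mat \<Rightarrow> nat" where
  "num_zero_entries M = card {(i, j). i < dim_row M \<and> j < dim_col M \<and> M $$ (i, j) = 0}"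

end

theory Submission imports Defs begin

text \<open>
  The sign \<open>(- 1) ^ \<omega>(M)\<close> is the product over all entries of \<open>1\<close> (nonzero entry) or \<open>- 1\<close> (zero entry),
  and one shows by induction on \<open>n\<close> that this sign times \<open>det M\<close> is positive. If the bottom right
  corner of \<open>M\<close> is nonzero, then \<open>M\<close> is an ordinary Cauchy matrix. Otherwise apply the
  Desnanot-Jacobi identity for the outer rows and columns. All minors in it belong to
  restricted Cauchy matrices, except that the one without first row and first column may have too
  large a block of zeros, and then it vanishes. Only the zero in the corner is not shared evenly
  between the two products of minors, so after multiplication with the signs their difference
  becomes a sum of a nonnegative and a positive number.
\<close>

section \<open>Schur complements of block matrices\<close>

lemma obtain_inverse_mat:
  fixes A :: "'a :: field mat"
  assumes A: "A \<in> carrier_mat n n" and "det A \<noteq> 0"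
  obtains G where "G \<in> carrier_mat n n" "A * G = 1\<^sub>m n" "G * A = 1\<^sub>m n"
proof -
  from det_non_zero_imp_unit[OF assms, unfolded Units_def, of "()"]
  obtain B where "B \<in> carrier_mat n n" "B * A = 1\<^sub>m n" "A * B = 1\<^sub>m n"
    by (auto simp: ring_mat_def)
  then show thesis
    using that by blast
qed

text \<open>Block LU factorization: the matrix is the product of a block lower triangular factor
  with diagonal \<open>A\<close>, \<open>1\<close> and a block upper triangular factor with diagonal
  \<open>1\<close>, \<open>D - C * (G * B)\<close>. The inverse \<open>G\<close> is a parameter, so
  that several bordered matrices can share it.\<close>

lemma det_four_block_mat_schur:
  fixes A B C D G :: "'a :: field mat"
  assumes A: "A \<in> carrier_mat n n" and B: "B \<in> carrier_mat n m"
    and C: "C \<in> carrier_mat m n" and D: "D \<in> carrier_mat m m"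
    and G: "G \<in> carrier_mat n n" and AG: "A * G = 1\<^sub>m n"
  shows "det (four_block_mat A B C D) = det A * det (D - C * (G * B))"
proof -
  let ?S = "D - C * (G * B)"
  have GB: "G * B \<in> carrier_mat n m" and CGB: "C * (G * B) \<in> carrier_mat m m"
    using B C G by auto
  have "four_block_mat A (0\<^sub>m n m) C (1\<^sub>m m) * four_block_mat (1\<^sub>m n) (G * B) (0\<^sub>m m n) ?S
      = four_block_mat (A * 1\<^sub>m n + 0\<^sub>m n m * 0\<^sub>m m n) (A * (G * B) + 0\<^sub>m n m * ?S)
          (C * 1\<^sub>m n + 1\<^sub>m m * 0\<^sub>m m n) (C * (G * B) + 1\<^sub>m m * ?S)"
    by (rule mult_four_block_mat[OF A zero_carrier_mat C one_carrier_mat one_carrier_mat GB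
          zero_carrier_mat minus_carrier_mat[OF CGB]])
  also have "A * 1\<^sub>m n + 0\<^sub>m n m * 0\<^sub>m m n = A"
    using A by simp
  also have "A * (G * B) + 0\<^sub>m n m * ?S = B"
    unfolding assoc_mult_mat[OF A G B, symmetric] AG left_mult_zero_mat[OF minus_carrier_mat[OF CGB]]
    using B by simp
  also have "C * 1\<^sub>m n + 1\<^sub>m m * 0\<^sub>m m n = C"
    using C by simp
  also have "C * (G * B) + 1\<^sub>m m * ?S = D"
    using C D CGB by (intro eq_matI) auto
  finally have "det (four_block_mat A B C D)
      = det (four_block_mat A (0\<^sub>m n m) C (1\<^sub>m m) * four_block_mat (1\<^sub>m n) (G * B) (0\<^sub>m m n) ?S)"
    by simp
  also have "\<dots> = det (four_block_mat A (0\<^sub>m n m) C (1\<^sub>m m)) * det (four_block_mat (1\<^sub>m n) (G * B) (0\<^sub>m m n) ?S)"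
    by (rule det_mult[OF four_block_carrier_mat[OF A one_carrier_mat]
          four_block_carrier_mat[OF one_carrier_mat minus_carrier_mat[OF CGB]]])
  also have "det (four_block_mat A (0\<^sub>m n m) C (1\<^sub>m m)) = det A"
    using det_four_block_mat_upper_right_zero[OF A refl C, of "1\<^sub>m m"] by simp
  also have "det (four_block_mat (1\<^sub>m n) (G * B) (0\<^sub>m m n) ?S) = det ?S"
    using det_four_block_mat_lower_left_zero[OF one_carrier_mat GB refl minus_carrier_mat[OF CGB]] by simp
  finally show ?thesis .
qed

lemma det_2x2:
  fixes A :: "'a :: comm_ring_1 mat"
  assumes A: "A \<in> carrier_mat 2 2"
  shows "det A = A $$ (0,0) * A $$ (1,1) - A $$ (0,1) * A $$ (1,0)"
proof -
  have "mat_delete A 0 j \<in> carrier_mat 1 1" for j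
    using A by (auto simp: mat_delete_def)
  then have "cofactor A 0 0 = A $$ (1,1)" "cofactor A 0 1 = - A $$ (1,0)"
    using A by (auto simp: cofactor_def det_single mat_delete_def)
  moreover have "{..<2} = {0, 1::nat}"
    by auto
  ultimately show ?thesis
    using laplace_expansion_row[OF A, of 0] by simp
qed

section \<open>The Desnanot-Jacobi identity\<close>

text \<open>This form singles out the last two rows and columns. Each \<open>f r c\<close> borders
  the leading block by row \<open>r\<close> and column \<open>c\<close>, so its Schur complement is
  one number \<open>s r c\<close>; the Schur complement of the whole matrix is the 2 x 2 matrix of
  these numbers, and the identity becomes the formula for its determinant.\<close>

lemma det_desnanot_jacobi_last:
  fixes K :: "nat \<Rightarrow> nat \<Rightarrow> 'a :: field" and n :: nat
  defines "f \<equiv> \<lambda>r c. det (mat (Suc n) (Suc n)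
    (\<lambda>(i, j). K (if i < n then i else r) (if j < n then j else c)))"
  assumes nz: "det (mat n n (\<lambda>(i, j). K i j)) \<noteq> 0"
  shows "det (mat (n + 2) (n + 2) (\<lambda>(i, j). K i j)) * det (mat n n (\<lambda>(i, j). K i j))
    = f n n * f (n + 1) (n + 1) - f n (n + 1) * f (n + 1) n"
proof -
  let ?A = "mat n n (\<lambda>(i, j). K i j)"
  have A: "?A \<in> carrier_mat n n" by simp
  obtain G where G: "G \<in> carrier_mat n n" and AG: "?A * G = 1\<^sub>m n"
    using obtain_inverse_mat[OF A nz] by metis
  define u where "u r = vec n (\<lambda>k. K r k)" for r
  define v where "v c = vec n (\<lambda>k. K k c)" for c
  define s where "s r c = K r c - u r \<bullet> (G *\<^sub>v v c)" for r c
  have f: "f r c = det ?A * s r c" for r c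
  proof -
    let ?B = "mat n 1 (\<lambda>(i, j). K i c)" and ?C = "mat 1 n (\<lambda>(i, j). K r j)"
      and ?D = "mat 1 1 (\<lambda>(i, j). K r c)"
    have "mat (Suc n) (Suc n) (\<lambda>(i, j). K (if i < n then i else r) (if j < n then j else c))
        = four_block_mat ?A ?B ?C ?D"
      by (intro eq_matI) auto
    then have "f r c = det ?A * det (?D - ?C * (G * ?B))"
      unfolding f_def using det_four_block_mat_schur[OF A _ _ _ G AG, of ?B 1 ?C ?D] by simp
    also have "row ?C 0 = u r" and "col ?B 0 = v c"
      by (auto simp: u_def v_def)
    then have "det (?D - ?C * (G * ?B)) = s r c"
      using G by (subst det_single) (auto simp: s_def scalar_prod_def mult_mat_vec_def)
    finally show ?thesis .
  qed
  let ?B = "mat n 2 (\<lambda>(i, j). K i (n + j))" and ?C = "mat 2 n (\<lambda>(i, j). K (n + i) j)"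
    and ?D = "mat 2 2 (\<lambda>(i, j). K (n + i) (n + j))"
  have "mat (n + 2) (n + 2) (\<lambda>(i, j). K i j) = four_block_mat ?A ?B ?C ?D"
    by (intro eq_matI) auto
  then have "det (mat (n + 2) (n + 2) (\<lambda>(i, j). K i j)) = det ?A * det (?D - ?C * (G * ?B))"
    using det_four_block_mat_schur[OF A _ _ _ G AG, of ?B 2 ?C ?D] by simp
  moreover have "?D - ?C * (G * ?B) = mat 2 2 (\<lambda>(i, j). s (n + i) (n + j))"
  proof -
    have "row ?C i = u (n + i)" "col ?B i = v (n + i)" if "i < 2" for i
      using that by (auto simp: u_def v_def)
    moreover have "row G k \<bullet> v c = (G *\<^sub>v v c) $ k" if "k < n" for k c
      using G that by simp
    ultimately show ?thesis
      using G by (intro eq_matI) (auto simp: s_def scalar_prod_def intro!: sum.cong)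
  qed
  ultimately have "det (mat (n + 2) (n + 2) (\<lambda>(i, j). K i j))
      = det ?A * (s n n * s (n + 1) (n + 1) - s n (n + 1) * s (n + 1) n)"
    by (simp add: det_2x2)
  then show ?thesis
    unfolding f by (simp only: mult_ac right_diff_distrib)
qed

lemma det_permute_rows_cols:
  fixes K :: "nat \<Rightarrow> nat \<Rightarrow> 'a :: comm_ring_1"
  assumes p: "p permutes {0..<n}" and q: "q permutes {0..<n}"
  shows "det (mat n n (\<lambda>(i, j). K (p i) (q j))) = of_int (sign p * sign q) * det (mat n n (\<lambda>(i, j). K i j))"
proof -
  let ?M = "mat n n (\<lambda>(i, j). K i (q j))"
  have pq: "p i < n" "q i < n" if "i < n" for i
    using that permutes_in_image[OF p, of i] permutes_in_image[OF q, of i] by auto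
  have "mat n n (\<lambda>(i, j). K (p i) (q j)) = mat n n (\<lambda>(i, j). ?M $$ (p i, j))"
    by (intro eq_matI) (auto simp: pq)
  then have "det (mat n n (\<lambda>(i, j). K (p i) (q j))) = of_int (sign p) * det ?M"
    using det_permute_rows[OF _ p, of ?M] by simp
  also have "det ?M = det (transpose_mat ?M)"
    by (rule det_transpose[symmetric, of _ n]) simp
  also have "transpose_mat ?M = mat n n (\<lambda>(i, j). mat n n (\<lambda>(i, j). K j i) $$ (q i, j))"
    by (intro eq_matI) (auto simp: pq)
  also have "det \<dots> = of_int (sign q) * det (mat n n (\<lambda>(i, j). K j i))"
    by (rule det_permute_rows[OF _ q]) simp
  also have "mat n n (\<lambda>(i, j). K j i) = transpose_mat (mat n n (\<lambda>(i, j). K i j))"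
    by (intro eq_matI) auto
  also have "det \<dots> = det (mat n n (\<lambda>(i, j). K i j))"
    by (rule det_transpose[of _ n]) simp
  finally show ?thesis
    by simp
qed

text \<open>Reindexing by this cycle puts row 0 at position \<open>n\<close>, directly after the
  inner rows, and leaves position \<open>n + 1\<close> alone. The outer rows thereby become the last
  two.\<close>

lemma cyclic_shift_permutes: "(\<lambda>i. if i < n then Suc i else if i = n then 0 else i) permutes {0..<Suc n}"
    (is "?p permutes _")
proof (rule bij_imp_permutes)
  have "inj_on ?p {0..<Suc n}"
    by (auto simp: inj_on_def split: if_splits)
  moreover have "?p ` {0..<Suc n} \<subseteq> {0..<Suc n}"
    by auto
  ultimately show "bij_betw ?p {0..<Suc n} {0..<Suc n}"
    unfolding bij_betw_def by (intro conjI endo_inj_surj finite_atLeastLessThan)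
qed auto

text \<open>The form for the first and last rows and columns follows from the previous one by cyclic
  reindexing of both rows and columns.\<close>

lemma det_desnanot_jacobi:
  fixes K :: "nat \<Rightarrow> nat \<Rightarrow> 'a :: field"
  assumes nz: "det (mat n n (\<lambda>(i, j). K (Suc i) (Suc j))) \<noteq> 0"
  shows "det (mat (n + 2) (n + 2) (\<lambda>(i, j). K i j)) * det (mat n n (\<lambda>(i, j). K (Suc i) (Suc j)))
    = det (mat (Suc n) (Suc n) (\<lambda>(i, j). K i j)) * det (mat (Suc n) (Suc n) (\<lambda>(i, j). K (Suc i) (Suc j)))
    - det (mat (Suc n) (Suc n) (\<lambda>(i, j). K i (Suc j))) * det (mat (Suc n) (Suc n) (\<lambda>(i, j). K (Suc i) j))"
proof -
  define p where "p i = (if i < n then Suc i else if i = n then 0 else i)" for i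
  have p: "p permutes {0..<Suc n}"
    unfolding p_def by (rule cyclic_shift_permutes)
  have p2: "p permutes {0..<n + 2}"
    by (rule permutes_subset[OF p]) auto
  define L where "L i j = K (p i) (p j)" for i j
  have sq: "(of_int (sign p) :: 'a) * of_int (sign p) = 1"
    by (metis of_int_1 of_int_mult sign_idempotent)
  have L0: "mat n n (\<lambda>(i, j). L i j) = mat n n (\<lambda>(i, j). K (Suc i) (Suc j))"
    by (intro eq_matI) (auto simp: L_def p_def)
  have L2: "det (mat (n + 2) (n + 2) (\<lambda>(i, j). L i j)) = det (mat (n + 2) (n + 2) (\<lambda>(i, j). K i j))"
    unfolding L_def by (subst det_permute_rows_cols[OF p2 p2]) (simp add: sq)
  \<comment> \<open>Bordering by position \<open>n\<close> yields the indices 0 to \<open>n\<close>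
    in cycled order; bordering by \<open>Suc n\<close> yields 1 to \<open>n + 1\<close> already in
    increasing order, because \<open>p\<close> fixes \<open>Suc n\<close>.\<close>
  have f: "mat (Suc n) (Suc n) (\<lambda>(i, j). L (if i < n then i else r) (if j < n then j else c))
      = mat (Suc n) (Suc n) (\<lambda>(i, j). K (if r = n then p i else Suc i) (if c = n then p j else Suc j))"
    if "r \<in> {n, Suc n}" "c \<in> {n, Suc n}" for r c
  proof -
    have "p (if i < n then i else r) = (if r = n then p i else Suc i)" if "i < Suc n" "r \<in> {n, Suc n}" for i r
      using that by (cases "i < n") (auto simp: p_def)
    with that show ?thesis
      unfolding L_def by (intro eq_matI) (simp_all only: dim_row_mat dim_col_mat index_mat prod.case)
  qed
  have id: "id permutes {0..<Suc n}"
    by (rule permutes_id)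
  \<comment> \<open>The sign of the cycle enters twice or not at all in the two diagonal minors, but
    once in each mixed minor; it cancels in the product of the mixed ones.\<close>
  define \<epsilon> :: 'a where "\<epsilon> = of_int (sign p)"
  have F: "det (mat (Suc n) (Suc n) (\<lambda>(i, j). L (if i < n then i else n) (if j < n then j else n)))
      = det (mat (Suc n) (Suc n) (\<lambda>(i, j). K i j))"
    "det (mat (Suc n) (Suc n) (\<lambda>(i, j). L (if i < n then i else n) (if j < n then j else Suc n)))
      = \<epsilon> * det (mat (Suc n) (Suc n) (\<lambda>(i, j). K i (Suc j)))"
    "det (mat (Suc n) (Suc n) (\<lambda>(i, j). L (if i < n then i else Suc n) (if j < n then j else n)))
      = \<epsilon> * det (mat (Suc n) (Suc n) (\<lambda>(i, j). K (Suc i) j))"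
    "det (mat (Suc n) (Suc n) (\<lambda>(i, j). L (if i < n then i else Suc n) (if j < n then j else Suc n)))
      = det (mat (Suc n) (Suc n) (\<lambda>(i, j). K (Suc i) (Suc j)))"
    using det_permute_rows_cols[OF p p, of K]
      det_permute_rows_cols[OF p id, of "\<lambda>i j. K i (Suc j)"]
      det_permute_rows_cols[OF id p, of "\<lambda>i j. K (Suc i) j"]
    by (simp_all add: f sq \<epsilon>_def)
  have \<epsilon>: "(\<epsilon> * x) * (\<epsilon> * y) = x * y" for x y
    using sq by (metis \<epsilon>_def mult.assoc mult.left_commute mult_1_left)
  show ?thesis
    using det_desnanot_jacobi_last[of n L, unfolded L0 L2, OF nz]
    unfolding Suc_eq_plus1[symmetric] F \<epsilon> .
qed

section \<open>Scaling and zero blocks in the Leibniz formula\<close>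

lemma det_scale_rows_cols:
  fixes K :: "nat \<Rightarrow> nat \<Rightarrow> 'a :: comm_ring_1"
  shows "det (mat n n (\<lambda>(i, j). r i * c j * K i j))
    = (\<Prod>i<n. r i) * (\<Prod>j<n. c j) * det (mat n n (\<lambda>(i, j). K i j))"
proof -
  have "(\<Prod>i = 0..<n. mat n n (\<lambda>(i, j). r i * c j * K i j) $$ (i, p i))
      = (\<Prod>i<n. r i) * (\<Prod>j<n. c j) * (\<Prod>i = 0..<n. mat n n (\<lambda>(i, j). K i j) $$ (i, p i))"
    if p: "p permutes {0..<n}" for p
  proof -
    have "p i < n" if "i < n" for i
      using that permutes_in_image[OF p, of i] by auto
    then have "(\<Prod>i = 0..<n. mat n n (\<lambda>(i, j). r i * c j * K i j) $$ (i, p i))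
        = (\<Prod>i = 0..<n. r i) * (\<Prod>i = 0..<n. c (p i)) * (\<Prod>i = 0..<n. mat n n (\<lambda>(i, j). K i j) $$ (i, p i))"
      by (simp add: prod.distrib)
    also have "(\<Prod>i = 0..<n. c (p i)) = (\<Prod>i = 0..<n. c i)"
      using prod.permute[OF p, of c] by (simp add: o_def)
    finally show ?thesis
      by (simp add: atLeast0LessThan)
  qed
  then have "(\<Sum>p | p permutes {0..<n}. of_int (sign p) * (\<Prod>i = 0..<n. mat n n (\<lambda>(i, j). r i * c j * K i j) $$ (i, p i)))
      = (\<Sum>p | p permutes {0..<n}. (\<Prod>i<n. r i) * (\<Prod>j<n. c j)
          * (of_int (sign p) * (\<Prod>i = 0..<n. mat n n (\<lambda>(i, j). K i j) $$ (i, p i))))"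
    by (intro sum.cong refl) (simp add: mult_ac)
  then show ?thesis
    by (simp add: det_def'[of _ n] sum_distrib_left[symmetric])
qed

text \<open>Pigeonhole: the \<open>n - k\<close> lower rows outnumber the first \<open>l\<close>
  columns, so every permutation sends some lower row into the zero block and every Leibniz term
  vanishes.\<close>

lemma det_zero_block:
  assumes A: "A \<in> carrier_mat n n" and kl: "k + l < n"
    and z: "\<And>i j. k \<le> i \<Longrightarrow> i < n \<Longrightarrow> l \<le> j \<Longrightarrow> j < n \<Longrightarrow> A $$ (i, j) = 0"
  shows "det A = 0"
proof -
  have "(\<Prod>i = 0..<n. A $$ (i, p i)) = 0" if p: "p permutes {0..<n}" for p
  proof -
    have "\<exists>i\<in>{k..<n}. p i \<ge> l"
    proof (rule ccontr)
      assume "\<not> ?thesis"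
      then have "p ` {k..<n} \<subseteq> {..<l}"
        by auto
      then have "card {k..<n} \<le> card {..<l}"
        by (rule card_inj_on_le[OF permutes_inj_on[OF p]]) simp
      with kl show False
        by simp
    qed
    then obtain i where "k \<le> i" "i < n" "l \<le> p i"
      by auto
    then have "A $$ (i, p i) = 0"
      using z permutes_in_image[OF p, of i] by auto
    with \<open>i < n\<close> show ?thesis
      by (intro prod_zero) auto
  qed
  then show ?thesis
    by (simp add: det_def'[OF A])
qed

section \<open>Cauchy matrices without zero entries\<close>

lemma det_cauchy_pos:
  fixes a b :: "nat \<Rightarrow> real"
  assumes "strict_antimono_on {..<n} a" "strict_mono_on {..<n} b"
    and "\<And>i j. i < n \<Longrightarrow> j < n \<Longrightarrow> a i > b j"
  shows "det (mat n n (\<lambda>(i, j). 1 / (a i - b j))) > 0"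
  using assms
proof (induction n arbitrary: a b)
  case 0
  then show ?case
    by simp
next
  case (Suc n)
  note gt = Suc.prems(3)
  have a: "a 0 > a (Suc i)" and b: "b 0 < b (Suc i)" if "i < n" for i
    using that Suc.prems(1,2) by (auto simp: monotone_on_def)
  let ?A = "mat 1 1 (\<lambda>(i, j). 1 / (a 0 - b 0))" and ?B = "mat 1 n (\<lambda>(i, j). 1 / (a 0 - b (Suc j)))"
    and ?C = "mat n 1 (\<lambda>(i, j). 1 / (a (Suc i) - b 0))" and ?D = "mat n n (\<lambda>(i, j). 1 / (a (Suc i) - b (Suc j)))"
    and ?G = "mat 1 1 (\<lambda>(i, j). a 0 - b 0)"
  \<comment> \<open>With x = \<open>a (Suc i)\<close> and y = \<open>b (Suc j)\<close>, these
    factors come from (x - b 0)(a 0 - y) - (a 0 - b 0)(x - y) = (a 0 - x)(y - b 0). Both are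
    positive by monotonicity.\<close>
  define r where "r i = (a 0 - a (Suc i)) / (a (Suc i) - b 0)" for i
  define c where "c j = (b (Suc j) - b 0) / (a 0 - b (Suc j))" for j
  have pos: "a 0 > b 0"
    using gt by simp
  have "mat (Suc n) (Suc n) (\<lambda>(i, j). 1 / (a i - b j)) = four_block_mat ?A ?B ?C ?D"
    by (intro eq_matI) auto
  moreover have "?A * ?G = 1\<^sub>m 1"
    using pos by (intro eq_matI) (auto simp: scalar_prod_def)
  ultimately have "det (mat (Suc n) (Suc n) (\<lambda>(i, j). 1 / (a i - b j)))
      = det ?A * det (?D - ?C * (?G * ?B))"
    using det_four_block_mat_schur[of ?A 1 ?B n ?C ?D ?G] by simp
  txt \<open>The Schur complement of the top left entry is again a Cauchy matrix up to row and column scaling.\<close>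
  also have "?D - ?C * (?G * ?B) = mat n n (\<lambda>(i, j). r i * c j * (1 / (a (Suc i) - b (Suc j))))"
  proof (intro eq_matI)
    fix i j assume "i < dim_row (mat n n (\<lambda>(i, j). r i * c j * (1 / (a (Suc i) - b (Suc j)))))"
      "j < dim_col (mat n n (\<lambda>(i, j). r i * c j * (1 / (a (Suc i) - b (Suc j)))))"
    then have ij: "i < n" "j < n"
      by auto
    have ne: "a (Suc i) - b (Suc j) \<noteq> 0" "a (Suc i) - b 0 \<noteq> 0" "a 0 - b (Suc j) \<noteq> 0"
      using gt[of "Suc i" "Suc j"] gt[of "Suc i" 0] gt[of 0 "Suc j"] ij by auto
    have "1 / (a (Suc i) - b (Suc j)) - (a 0 - b 0) / ((a (Suc i) - b 0) * (a 0 - b (Suc j)))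
        = r i * c j * (1 / (a (Suc i) - b (Suc j)))"
      using ne by (simp add: r_def c_def divide_simps) (simp add: algebra_simps)
    then show "(?D - ?C * (?G * ?B)) $$ (i, j)
        = mat n n (\<lambda>(i, j). r i * c j * (1 / (a (Suc i) - b (Suc j)))) $$ (i, j)"
      using ij by (simp add: scalar_prod_def)
  qed auto
  finally have "det (mat (Suc n) (Suc n) (\<lambda>(i, j). 1 / (a i - b j)))
      = 1 / (a 0 - b 0) * ((\<Prod>i<n. r i) * (\<Prod>j<n. c j) * det ?D)"
    by (simp only: det_scale_rows_cols) (simp add: det_single)
  moreover have "(\<Prod>i<n. r i) > 0" "(\<Prod>j<n. c j) > 0"
    using a b gt[of _ 0] gt[of 0] by (auto intro!: prod_pos simp: r_def c_def)
  moreover have "det ?D > 0"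
    using Suc.prems by (intro Suc.IH[of "\<lambda>i. a (Suc i)" "\<lambda>i. b (Suc i)"]) (auto simp: monotone_on_def)
  ultimately show ?case
    using pos by simp
qed

section \<open>Restricted Cauchy matrices: minors and signs\<close>

definition cauchy_kernel :: "real \<Rightarrow> real \<Rightarrow> real" where
  "cauchy_kernel x y = (if x > y then 1 / (x - y) else 0)"

definition cauchy_sgn :: "real \<Rightarrow> real \<Rightarrow> real" where
  "cauchy_sgn x y = (if x > y then 1 else - 1)"

definition cauchy_det :: "nat \<Rightarrow> (nat \<Rightarrow> real) \<Rightarrow> (nat \<Rightarrow> real) \<Rightarrow> real" where
  "cauchy_det n a b = det (mat n n (\<lambda>(i, j). cauchy_kernel (a i) (b j)))"

text \<open>As a product, the sign splits along the rows and columns that a minor omits.\<close>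

definition zeros_sgn :: "nat \<Rightarrow> (nat \<Rightarrow> real) \<Rightarrow> (nat \<Rightarrow> real) \<Rightarrow> real" where
  "zeros_sgn n a b = (\<Prod>i<n. \<Prod>j<n. cauchy_sgn (a i) (b j))"

text \<open>By monotonicity a violation at row \<open>i\<close> spreads to all entries below and to
  the right, and this zero block is just large enough:
  \<open>i + (n - 1 - i) = n - 1 < n\<close>.\<close>

lemma cauchy_det_eq_0:
  assumes a: "strict_antimono_on {..<n} a" and b: "strict_mono_on {..<n} b"
    and i: "i < n" "a i \<le> b (n - 1 - i)"
  shows "cauchy_det n a b = 0"
  unfolding cauchy_det_def
proof (rule det_zero_block[of _ n i "n - 1 - i"])
  fix i' j assume ij: "i \<le> i'" "i' < n" "n - 1 - i \<le> j" "j < n"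
  have "a i' \<le> a i"
    using monotone_onD[OF a, of i i'] ij by (cases "i = i'") auto
  moreover have "b (n - 1 - i) \<le> b j"
    using monotone_onD[OF b, of "n - 1 - i" j] ij by (cases "n - 1 - i = j") auto
  ultimately show "mat n n (\<lambda>(i, j). cauchy_kernel (a i) (b j)) $$ (i', j) = 0"
    using i ij by (simp add: cauchy_kernel_def)
qed (use i in auto)

lemma zeros_sgn_cauchy_det_pos:
  assumes "strict_antimono_on {..<n} a" "strict_mono_on {..<n} b"
    and "\<And>i. i < n \<Longrightarrow> a i > b (n - 1 - i)"
  shows "zeros_sgn n a b * cauchy_det n a b > 0"
  using assms
proof (induction n arbitrary: a b rule: less_induct)
  case (less n)
  note a = less.prems(1) and b = less.prems(2) and stair = less.prems(3)
  have a_le: "a j \<le> a i" if "i \<le> j" "j < n" for i j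
    using monotone_onD[OF a, of i j] that by (cases "i = j") auto
  have b_le: "b i \<le> b j" if "i \<le> j" "j < n" for i j
    using monotone_onD[OF b, of i j] that by (cases "i = j") auto
  \<comment> \<open>For \<open>n = 1\<close> the hypothesis at index 0 makes the corner nonzero, so
    a zero corner forces \<open>n\<close> to be at least 2.\<close>
  consider "n = 0" | m where "n = Suc m" "a m > b m" | k where "n = k + 2" "\<not> a (Suc k) > b (Suc k)"
    using stair[of 0] by (cases n rule: nat.exhaust; cases "n - 1") force+
  then show ?case
  proof cases
    case 1
    then show ?thesis
      by (simp add: zeros_sgn_def cauchy_det_def)
  next
    case (2 m)
    have gt: "a i > b j" if "i < n" "j < n" for i j
      using a_le[of i m] b_le[of j m] 2 that by simp
    then have "zeros_sgn n a b = 1"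
      by (simp add: zeros_sgn_def cauchy_sgn_def)
    moreover have "mat n n (\<lambda>(i, j). cauchy_kernel (a i) (b j)) = mat n n (\<lambda>(i, j). 1 / (a i - b j))"
      using gt by (intro eq_matI) (auto simp: cauchy_kernel_def)
    ultimately show ?thesis
      using det_cauchy_pos[OF a b gt] by (simp add: cauchy_det_def)
  next
    case (3 k)
    define a' where "a' i = a (Suc i)" for i
    define b' where "b' i = b (Suc i)" for i
    note n = \<open>n = k + 2\<close>
    have mono: "strict_antimono_on {..<Suc k} a" "strict_antimono_on {..<Suc k} a'" "strict_antimono_on {..<k} a'"
      "strict_mono_on {..<Suc k} b" "strict_mono_on {..<Suc k} b'" "strict_mono_on {..<k} b'"
      using a b by (auto simp: monotone_on_def n a'_def b'_def)
    define W where "W m x y = zeros_sgn m x y * cauchy_det m x y" for m x y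
    have stair': "a i > b (Suc k - i)" if "i < k + 2" for i
      using stair[of i] that by (simp add: n)
    have pos0: "W k a' b' > 0"
      unfolding W_def
    proof (rule less.IH)
      show "b' (k - 1 - i) < a' i" if "i < k" for i
        using stair'[of "Suc i"] that by (simp add: a'_def b'_def Suc_diff_Suc)
    qed (use mono n in auto)
    \<comment> \<open>Deleting the last row and column relaxes the condition to
      \<open>a i > b (k - i)\<close>. For the inner minor and the two mixed minors it is a part of
      the original condition, merely reindexed.\<close>
    have pos1: "W (Suc k) a b > 0"
      unfolding W_def
    proof (rule less.IH)
      show "b (Suc k - 1 - i) < a i" if "i < Suc k" for i
      proof -
        have "b (k - i) \<le> b (Suc k - i)"
          by (rule b_le) (use n in arith)+
        with stair'[of i] that show ?thesis
          by simp
      qed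
    qed (use mono n in auto)
    have pos2: "W (Suc k) a b' > 0"
      unfolding W_def
    proof (rule less.IH)
      show "b' (Suc k - 1 - i) < a i" if "i < Suc k" for i
        using stair'[of i] that by (simp add: b'_def Suc_diff_le)
    qed (use mono n in auto)
    have pos3: "W (Suc k) a' b > 0"
      unfolding W_def
    proof (rule less.IH)
      show "b (Suc k - 1 - i) < a' i" if "i < Suc k" for i
        using stair'[of "Suc i"] that by (simp add: a'_def)
    qed (use mono n in auto)
    \<comment> \<open>Here the condition would read \<open>a (Suc i) > b (Suc k - i)\<close>, which
      is stronger than the given one and can fail.\<close>
    have nonneg: "W (Suc k) a' b' \<ge> 0"
    proof (cases "\<forall>i<Suc k. b' (Suc k - 1 - i) < a' i")
      case True
      then have "W (Suc k) a' b' > 0"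
        unfolding W_def by (intro less.IH) (use mono n in auto)
      then show ?thesis
        by simp
    next
      case False
      then obtain i where "i < Suc k" "a' i \<le> b' (Suc k - 1 - i)"
        by (auto simp: not_less)
      then have "cauchy_det (Suc k) a' b' = 0"
        by (rule cauchy_det_eq_0[OF mono(2,5)])
      then show ?thesis
        by (simp add: W_def)
    qed
    \<comment> \<open>\<open>r\<close> and \<open>c\<close> are the signs of the last row and the
      last column without the corner. The first row and first column contribute only factors 1,
      since \<open>a 0\<close> exceeds the largest \<open>b\<close> and \<open>b 0\<close> lies
      below every \<open>a i\<close>.\<close>
    define r where "r = (\<Prod>j<k. cauchy_sgn (a' k) (b' j))"
    define c where "c = (\<Prod>i<k. cauchy_sgn (a' i) (b' k))"
    have row0: "cauchy_sgn (a 0) (b j) = 1" if "j < k + 2" for j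
      using stair'[of 0] b_le[of j "Suc k"] that by (simp add: cauchy_sgn_def n)
    have row0': "cauchy_sgn (a 0) (b' j) = 1" if "j < Suc k" for j
      using row0[of "Suc j"] that by (simp add: b'_def)
    have col0: "cauchy_sgn (a i) (b 0) = 1" if "i < k + 2" for i
    proof -
      have "b 0 \<le> b (Suc k - i)"
        by (rule b_le) (use n in arith)+
      with stair'[of i] that show ?thesis
        by (simp add: cauchy_sgn_def)
    qed
    have col0': "cauchy_sgn (a' i) (b 0) = 1" if "i < Suc k" for i
      using col0[of "Suc i"] that by (simp add: a'_def)
    have corner: "cauchy_sgn (a' k) (b' k) = - 1"
      using 3 by (simp add: cauchy_sgn_def a'_def b'_def)
    have S11: "zeros_sgn (Suc k) a' b' = - (zeros_sgn k a' b' * r * c)"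
      by (simp add: zeros_sgn_def corner prod.distrib r_def c_def)
    have S: "zeros_sgn (k + 2) a b = zeros_sgn (Suc k) a' b'"
      by (simp add: zeros_sgn_def prod.lessThan_Suc_shift row0 row0' col0 col0' a'_def[symmetric] b'_def[symmetric] del: prod.lessThan_Suc)
    have Snn: "zeros_sgn (Suc k) a b = zeros_sgn k a' b'"
      by (simp add: zeros_sgn_def prod.lessThan_Suc_shift row0 row0' col0 col0' a'_def[symmetric] b'_def[symmetric] del: prod.lessThan_Suc)
    have S1n: "zeros_sgn (Suc k) a b' = zeros_sgn k a' b' * c"
    proof -
      have "zeros_sgn (Suc k) a b' = (\<Prod>i<k. \<Prod>j<Suc k. cauchy_sgn (a' i) (b' j))"
        by (simp add: zeros_sgn_def prod.lessThan_Suc_shift[of _ k] row0' a'_def del: prod.lessThan_Suc)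
      then show ?thesis
        by (simp add: zeros_sgn_def prod.distrib c_def)
    qed
    have Sn1: "zeros_sgn (Suc k) a' b = zeros_sgn k a' b' * r"
    proof -
      have "zeros_sgn (Suc k) a' b = (\<Prod>i<Suc k. \<Prod>j<k. cauchy_sgn (a' i) (b' j))"
        unfolding zeros_sgn_def
        by (rule prod.cong) (simp_all add: prod.lessThan_Suc_shift col0' b'_def del: prod.lessThan_Suc)
      then show ?thesis
        by (simp add: zeros_sgn_def r_def)
    qed
    have "cauchy_det k a' b' \<noteq> 0"
      using pos0 by (auto simp: W_def)
    then have "cauchy_det (k + 2) a b * cauchy_det k a' b'
        = cauchy_det (Suc k) a b * cauchy_det (Suc k) a' b' - cauchy_det (Suc k) a b' * cauchy_det (Suc k) a' b"
      unfolding cauchy_det_def a'_def b'_def by (rule det_desnanot_jacobi)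
    \<comment> \<open>Write s for \<open>zeros_sgn k a' b'\<close>. The multiplier equals - s s r c,
      as does the sign product of the first pair of minors, whereas that of the mixed pair is s s r
      c. Hence the minus sign of the identity turns into a plus.\<close>
    then have "zeros_sgn (k + 2) a b * zeros_sgn k a' b' * (cauchy_det (k + 2) a b * cauchy_det k a' b')
        = zeros_sgn (k + 2) a b * zeros_sgn k a' b' *
          (cauchy_det (Suc k) a b * cauchy_det (Suc k) a' b' - cauchy_det (Suc k) a b' * cauchy_det (Suc k) a' b)"
      by simp
    then have "W (k + 2) a b * W k a' b' = W (Suc k) a b * W (Suc k) a' b' + W (Suc k) a b' * W (Suc k) a' b"
      unfolding W_def S Snn S1n Sn1 S11 by (simp add: algebra_simps)
    also have "\<dots> > 0"
      using pos1 pos2 pos3 nonneg by (intro add_nonneg_pos mult_nonneg_nonneg mult_pos_pos) auto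
    finally have "W (k + 2) a b > 0"
      using pos0 by (rule zero_less_mult_pos2)
    then show ?thesis
      by (simp only: W_def n)
  qed
qed

section \<open>From the sign product to the count of zero entries\<close>

lemma zeros_sgn_eq: "zeros_sgn n a b = (- 1) ^ num_zero_entries (cauchy_mat n a b)"
proof -
  \<comment> \<open>A quotient \<open>1 / (a i - b j)\<close> with \<open>a i > b j\<close> is never
    0, so zeros arise only from the \<open>else\<close> branch.\<close>
  have "{(i, j). i < n \<and> j < n \<and> cauchy_mat n a b $$ (i, j) = 0} = {..<n} \<times> {..<n} \<inter> - {(i, j). a i > b j}"
    by (auto simp: cauchy_mat_def split: if_splits)
  moreover have "dim_row (cauchy_mat n a b) = n" "dim_col (cauchy_mat n a b) = n"
    by (simp_all add: cauchy_mat_def)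
  moreover have "zeros_sgn n a b = (\<Prod>x\<in>{..<n} \<times> {..<n}. if x \<in> {(i, j). a i > b j} then 1 else - 1)"
    by (simp add: zeros_sgn_def cauchy_sgn_def prod.cartesian_product case_prod_unfold)
  ultimately show ?thesis
    by (simp add: num_zero_entries_def prod.If_cases)
qed

theorem theorem2p1:
  fixes n :: nat and a b :: "nat \<Rightarrow> real"
  assumes "n \<ge> 1"
    and "strict_antimono_on {..<n} a"
    and "strict_mono_on {..<n} b"
    and "\<And>i. i < n \<Longrightarrow> a i > b (n - 1 - i)"
    and "\<And>i j. i < n \<Longrightarrow> j < n \<Longrightarrow> a i \<noteq> b j"
  defines "M \<equiv> cauchy_mat n a b"
  shows "invertible_mat M
    \<and> (even (num_zero_entries M) \<longrightarrow> det M > 0)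
    \<and> (odd (num_zero_entries M) \<longrightarrow> det M < 0)"
proof -
  have "cauchy_det n a b = det M"
    by (simp add: M_def cauchy_mat_def cauchy_det_def cauchy_kernel_def)
  then have pos: "(- 1) ^ num_zero_entries M * det M > 0"
    using zeros_sgn_cauchy_det_pos[OF assms(2-4)] by (simp add: zeros_sgn_eq M_def)
  have M: "M \<in> carrier_mat n n"
    by (simp add: M_def cauchy_mat_def)
  have "det M \<noteq> 0"
    using pos by auto
  then obtain G where "G \<in> carrier_mat n n" "M * G = 1\<^sub>m n" "G * M = 1\<^sub>m n"
    using obtain_inverse_mat[OF M] by metis
  then have "invertible_mat M"
    using M by (auto simp: invertible_mat_def inverts_mat_def)
  with pos show ?thesis
    by (auto simp: minus_one_power_iff)
qed

end
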